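(* Suppose that $S \neq \emptyset$ and $L_\infty \neq \emptyset$, where $L_\infty = \{d \in \mathbb{R}^n : Ad = 0,\ d \ge 0,\ d^TQd < 0\}$. Then, for any $\mathcal{K} \in \mathbb{K}$, $\ell_{\mathcal{K}}(\tilde{x}) = -\infty$ for any $\tilde{x} \in S$, and $\ell_{\mathcal{K}} = \ell^* = -\infty$.
   Context: Quadratic program: let $Q \in \mathbb{R}^{n\times n}$ be symmetric, $c \in \mathbb{R}^n$, $A \in \mathbb{R}^{m \times n}$, $b \in \mathbb{R}^m$; put $q(x) = x^T Q x + 2c^T x$ and $S = \{x \in \mathbb{R}^n : Ax = b,\ x \ge 0\}$. $(QP)$ is the problem of minimizing $q(x)$ over $x \in S$, with optimal value (infimum) $\ell^* \in \mathbb{R}\cup\{-\infty,+\infty\}$. $\mathcal{S}^N$ denotes the real symmetric $N\times N$ matrices, and $\langle U,V\rangle = \sum_{i,j} U_{ij}V_{ij}$. Rows and columns of matrices in $\mathcal{S}^{n+1}$ are indexed by $0,1,\ldots,n$. $\mathcal{CP}^N = \{\sum_{j=1}^k y^j (y^j)^T : k \ge 1,\ y^j \in \mathbb{R}^N_+\}$ is the cone of completely positive matrices, and $\mathcal{P}^{n+1}$ is the cone of positive semidefinite $Y \in \mathcal{S}^{n+1}$ with $Y_{0j} \ge 0$ for $j = 1,\ldots,n$. $\mathbb{K}$ is the family of all closed convex cones $\mathcal{K} \subseteq \mathcal{S}^{n+1}$ with $\mathcal{CP}^{n+1} \subseteq \mathcal{K} \subseteq \mathcal{P}^{n+1}$.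 Let \[ \widehat{Q} = \begin{bmatrix} 0 & c^T \\ c & Q\end{bmatrix}, \qquad \widehat{A} = \begin{bmatrix} b^Tb & -b^TA \\ -A^Tb & A^TA\end{bmatrix}. \] $(P(\mathcal{K}))$: minimize $\langle \widehat{Q}, Y\rangle$ subject to $\langle \widehat{A}, Y\rangle = 0$, $Y_{00} = 1$, $Y \in \mathcal{K}$; its optimal value (infimum) is $\ell_{\mathcal{K}}$. For $\tilde{x} \in S$, $(P(\mathcal{K},\tilde{x}))$ is the same problem with the additional constraint that $(Y_{01},\ldots,Y_{0n}) = \tilde{x}^T$; its optimal value (infimum) is $\ell_{\mathcal{K}}(\tilde{x})$. *)

theory Defs
  imports "HOL-Analysis.Analysis"
begin

text \<open>
  Matrices in \<open>\<real>\<^sup>m\<^sup>\<times>\<^sup>n\<close> have type \<open>real ^ 'n ^ 'm\<close>. The index set \<open>{0, 1, \<dots>, n}\<close> is rendered as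
  \<open>'n option\<close>: \<open>None\<close> is the index \<open>0\<close>, and \<open>Some j\<close> is the original index \<open>j\<close>.
  On vectors, \<open>\<le>\<close> is the componentwise order; on matrices, \<open>U \<bullet> V\<close> is the sum of all
  \<open>U $ i $ j * V $ i $ j\<close>. Optimal values are infima in \<open>ereal\<close>, so they are \<open>\<infinity>\<close> for an
  infeasible problem.
\<close>

definition qp_objective :: "real ^ 'n ^ 'n \<Rightarrow> real ^ 'n \<Rightarrow> real ^ 'n \<Rightarrow> real" where
  "qp_objective Q c x = x \<bullet> (Q *v x) + 2 * (c \<bullet> x)"

definition qp_feasible :: "real ^ 'n ^ 'm \<Rightarrow> real ^ 'm \<Rightarrow> (real ^ 'n) set" where
  "qp_feasible A b = {x. A *v x = b \<and> 0 \<le> x}"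

definition qp_value ::
  "real ^ 'n ^ 'n \<Rightarrow> real ^ 'n \<Rightarrow> real ^ 'n ^ 'm \<Rightarrow> real ^ 'm \<Rightarrow> ereal" where
  "qp_value Q c A b = (INF x\<in>qp_feasible A b. ereal (qp_objective Q c x))"

definition L_infinity :: "real ^ 'n ^ 'n \<Rightarrow> real ^ 'n ^ 'm \<Rightarrow> (real ^ 'n) set" where
  "L_infinity Q A = {d. A *v d = 0 \<and> 0 \<le> d \<and> d \<bullet> (Q *v d) < 0}"

definition self_outer :: "real ^ 'k \<Rightarrow> real ^ 'k ^ 'k" where
  "self_outer y = (\<chi> i j. y $ i * y $ j)"

definition completely_positive :: "(real ^ 'k ^ 'k) set" where
  "completely_positive =
     {\<Sum>j=1..k. self_outer (y j) | (k::nat) y. 1 \<le> k \<and> (\<forall>j\<in>{1..k}. 0 \<le> y j)}"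

definition positive_semidefinite :: "real ^ 'k ^ 'k \<Rightarrow> bool" where
  "positive_semidefinite Y \<longleftrightarrow> transpose Y = Y \<and> (\<forall>x. 0 \<le> x \<bullet> (Y *v x))"

definition psd_nonneg_row :: "(real ^ ('n::finite) option ^ 'n option) set" where
  "psd_nonneg_row = {Y. positive_semidefinite Y \<and> (\<forall>j. 0 \<le> Y $ None $ Some j)}"

text \<open>
  Members of this family are cones of symmetric matrices, because \<^const>\<open>psd_nonneg_row\<close>
  contains only symmetric matrices.
\<close>
definition cone_family :: "(real ^ ('n::finite) option ^ 'n option) set set" where
  "cone_family = {K. closed K \<and> convex K \<and> cone K \<and>
     completely_positive \<subseteq> K \<and> K \<subseteq> psd_nonneg_row}"

text \<open>The symmetric block matrix with first row \<open>(a, v\<^sup>T)\<close>, first column \<open>(a, v)\<close> and lower right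
  block \<open>M\<close>.\<close>
definition bordered :: "real \<Rightarrow> real ^ 'n \<Rightarrow> real ^ 'n ^ 'n \<Rightarrow> real ^ ('n::finite) option ^ 'n option" where
  "bordered a v M = (\<chi> i j. case i of
       None \<Rightarrow> (case j of None \<Rightarrow> a | Some l \<Rightarrow> v $ l)
     | Some k \<Rightarrow> (case j of None \<Rightarrow> v $ k | Some l \<Rightarrow> M $ k $ l))"

definition Q_hat :: "real ^ 'n ^ 'n \<Rightarrow> real ^ 'n \<Rightarrow> real ^ ('n::finite) option ^ 'n option" where
  "Q_hat Q c = bordered 0 c Q"

definition A_hat :: "real ^ 'n ^ 'm \<Rightarrow> real ^ 'm \<Rightarrow> real ^ ('n::finite) option ^ 'n option" where
  "A_hat A b = bordered (b \<bullet> b) (- (transpose A *v b)) (transpose A ** A)"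

definition relax_feasible ::
  "(real ^ ('n::finite) option ^ 'n option) set \<Rightarrow> real ^ 'n ^ 'm \<Rightarrow> real ^ 'm
     \<Rightarrow> (real ^ ('n::finite) option ^ 'n option) set" where
  "relax_feasible K A b = {Y. A_hat A b \<bullet> Y = 0 \<and> Y $ None $ None = 1 \<and> Y \<in> K}"

definition relax_value ::
  "(real ^ ('n::finite) option ^ 'n option) set \<Rightarrow> real ^ 'n ^ 'n \<Rightarrow> real ^ 'n \<Rightarrow> real ^ 'n ^ 'm
     \<Rightarrow> real ^ 'm \<Rightarrow> ereal" where
  "relax_value K Q c A b = (INF Y\<in>relax_feasible K A b. ereal (Q_hat Q c \<bullet> Y))"

definition relax_value_at ::
  "(real ^ ('n::finite) option ^ 'n option) set \<Rightarrow> real ^ 'n ^ 'n \<Rightarrow> real ^ 'n \<Rightarrow> real ^ 'n ^ 'm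
     \<Rightarrow> real ^ 'm \<Rightarrow> real ^ 'n \<Rightarrow> ereal" where
  "relax_value_at K Q c A b x =
     (INF Y\<in>{Y \<in> relax_feasible K A b. (\<chi> j. Y $ None $ Some j) = x}. ereal (Q_hat Q c \<bullet> Y))"

end

theory Submission
  imports Defs
begin

text \<open>
  For \<open>x \<in> S\<close> and \<open>d \<in> L\<^sub>\<infinity>\<close>, both \<open>(1, x)(1, x)\<^sup>T\<close> and \<open>(0, d)(0, d)\<^sup>T\<close> are annihilated by the
  positive semidefinite form of \<open>A_hat\<close>. Hence the completely positive matrices
  \<open>(1, x)(1, x)\<^sup>T + t (0, d)(0, d)\<^sup>T\<close> with \<open>t \<ge> 0\<close> are feasible for every relaxation, they all have
  the same first row, and their objective value \<open>q(x) + t d\<^sup>TQd\<close> is unbounded below. On the ray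
  \<open>x + t d\<close> inside \<open>S\<close>, the quadratic \<open>q\<close> has negative leading coefficient \<open>d\<^sup>TQd\<close>.
\<close>

definition homogenize :: "real \<Rightarrow> real ^ 'n \<Rightarrow> real ^ ('n::finite) option" where
  "homogenize s u = (\<chi> i. case i of None \<Rightarrow> s | Some k \<Rightarrow> u $ k)"

lemma homogenize_nth [simp]:
  "homogenize s u $ None = s" "homogenize s u $ Some k = u $ k"
  by (simp_all add: homogenize_def)

lemma homogenize_nonneg: "0 \<le> homogenize s u \<longleftrightarrow> 0 \<le> s \<and> 0 \<le> u"
  by (simp add: less_eq_vec_def split_option_all)

lemma sum_UNIV_option:
  "(\<Sum>i\<in>UNIV. f i) = f None + (\<Sum>k\<in>UNIV. f (Some k))" for f :: "'n::finite option \<Rightarrow> real"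
  by (simp add: UNIV_option_conv sum.reindex)

text \<open>The lifting behind the relaxation: a linear functional of a rank-one matrix is a
  quadratic form in its generator.\<close>

lemma inner_self_outer: "M \<bullet> self_outer y = y \<bullet> (M *v y)"
  by (simp add: inner_vec_def self_outer_def matrix_vector_mult_def sum_distrib_left mult_ac)

lemma bordered_mult_homogenize:
  "bordered a v M *v homogenize s u = homogenize (a * s + v \<bullet> u) (s *\<^sub>R v + M *v u)"
  by (simp add: vec_eq_iff split_option_all matrix_vector_mult_def bordered_def
      sum_UNIV_option inner_vec_def mult.commute)

lemma homogenize_inner: "homogenize s u \<bullet> homogenize s' u' = s * s' + u \<bullet> u'"
  by (simp add: inner_vec_def sum_UNIV_option)

lemma bordered_inner_self_outer:
  "bordered a v M \<bullet> self_outer (homogenize s u) = a * s\<^sup>2 + 2 * s * (v \<bullet> u) + u \<bullet> (M *v u)"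
  by (simp add: inner_self_outer bordered_mult_homogenize homogenize_inner inner_add_right
      inner_commute[of u v] power2_eq_square algebra_simps)

text \<open>\<open>A_hat A b\<close> is the Gram matrix of the block row \<open>[b, -A]\<close>, so
  its form is a squared residual. It vanishes at \<open>(1, x)\<close> when
  \<open>A *v x = b\<close> and at \<open>(0, d)\<close> when \<open>A *v d = 0\<close>.\<close>

lemma A_hat_inner_self_outer:
  "A_hat A b \<bullet> self_outer (homogenize s u) = (norm (s *\<^sub>R b - A *v u))\<^sup>2"
proof -
  have *: "(transpose A *v w) \<bullet> u = w \<bullet> (A *v u)" for w
    by (simp add: dot_lmul_matrix)
  have "u \<bullet> ((transpose A ** A) *v u) = (A *v u) \<bullet> (A *v u)"
    by (metis * inner_commute matrix_vector_mul_assoc)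
  then have "A_hat A b \<bullet> self_outer (homogenize s u) =
      (b \<bullet> b) * s\<^sup>2 - 2 * s * (b \<bullet> (A *v u)) + (A *v u) \<bullet> (A *v u)"
    unfolding A_hat_def bordered_inner_self_outer inner_minus_left * by simp
  also have "\<dots> = (norm (s *\<^sub>R b - A *v u))\<^sup>2"
    unfolding power2_norm_eq_inner
    by (simp add: inner_diff_left inner_diff_right inner_commute[of "A *v u" b]
        power2_eq_square algebra_simps)
  finally show ?thesis .
qed

lemma Q_hat_inner_self_outer:
  "Q_hat Q c \<bullet> self_outer (homogenize s u) = u \<bullet> (Q *v u) + 2 * s * (c \<bullet> u)"
  by (simp add: Q_hat_def bordered_inner_self_outer)

lemma self_outer_scaleR: "self_outer (r *\<^sub>R y) = r\<^sup>2 *\<^sub>R self_outer y"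
  by (simp add: self_outer_def vec_eq_iff power2_eq_square)

lemma self_outer_add_in_completely_positive:
  assumes "0 \<le> y" "0 \<le> z"
  shows "self_outer y + self_outer z \<in> completely_positive"
proof -
  have "self_outer y + self_outer z = (\<Sum>j=1..2. self_outer (if j = (1::nat) then y else z))"
    by (simp add: numeral_2_eq_2)
  then show ?thesis
    unfolding completely_positive_def using assms
    by (intro CollectI exI[of _ 2] exI[of _ "\<lambda>j. if j = 1 then y else z"]) auto
qed

lemma INF_ereal_eq_MInfI:
  assumes "\<And>B. \<exists>y\<in>S. f y \<le> B"
  shows "(INF y\<in>S. ereal (f y)) = - \<infinity>"
proof (rule ereal_bot)
  fix B
  obtain y where "y \<in> S" "f y \<le> B" using assms by blast
  then show "(INF y\<in>S. ereal (f y)) \<le> ereal B" by (intro INF_lower2[of y]) auto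
qed

lemma relax_value_at_eq_MInf:
  assumes K: "completely_positive \<subseteq> K"
    and x: "x \<in> qp_feasible A b" and d: "d \<in> L_infinity Q A"
  shows "relax_value_at K Q c A b x = - \<infinity>"
  unfolding relax_value_at_def
proof (rule INF_ereal_eq_MInfI)
  fix B
  have x': "A *v x = b" "0 \<le> x" and d': "A *v d = 0" "0 \<le> d" "d \<bullet> (Q *v d) < 0"
    using x d by (auto simp: qp_feasible_def L_infinity_def)
  \<comment> \<open>Makes the decrease \<open>t * (d \<bullet> (Q *v d))\<close> equal to minus the
    gap between \<open>B\<close> and the objective at \<open>x\<close>; the absolute value keeps
    \<open>t\<close> nonnegative when \<open>x\<close> already lies below \<open>B\<close>.\<close>
  define t where "t = \<bar>B - qp_objective Q c x\<bar> / - (d \<bullet> (Q *v d))"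
  have t: "0 \<le> t" "t * (d \<bullet> (Q *v d)) = - \<bar>B - qp_objective Q c x\<bar>"
    using d'(3) by (auto simp: t_def field_simps)
  \<comment> \<open>Sums in \<open>completely_positive\<close> carry no coefficients, so the weight
    \<open>t\<close> enters the generator as \<open>sqrt t\<close>.\<close>
  define Y where "Y = self_outer (homogenize 1 x) + self_outer (sqrt t *\<^sub>R homogenize 0 d)"
  have "0 \<le> sqrt t *\<^sub>R homogenize 0 d"
    using t(1) d'(2) by (simp add: less_eq_vec_def split_option_all)
  then have "Y \<in> K"
    using K x'(2) unfolding Y_def
    by (intro subsetD[OF K] self_outer_add_in_completely_positive) (simp_all add: homogenize_nonneg)
  moreover have "A_hat A b \<bullet> Y = 0"
    using x'(1) d'(1) by (simp add: Y_def self_outer_scaleR inner_add_right A_hat_inner_self_outer)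
  moreover have "Y $ None $ None = 1" "(\<chi> j. Y $ None $ Some j) = x"
    by (simp_all add: Y_def self_outer_def vec_eq_iff)
  \<comment> \<open>The leading entry 0 of the second generator removes its linear term, and adding
    matrices instead of vectors avoids mixed terms: the objective is affine in
    \<open>t\<close>.\<close>
  moreover have "Q_hat Q c \<bullet> Y = qp_objective Q c x + t * (d \<bullet> (Q *v d))"
    using t(1) by (simp add: Y_def self_outer_scaleR inner_add_right Q_hat_inner_self_outer
        qp_objective_def)
  ultimately show "\<exists>Y\<in>{Y \<in> relax_feasible K A b. (\<chi> j. Y $ None $ Some j) = x}.
      Q_hat Q c \<bullet> Y \<le> B"
    using t(2) by (intro bexI[of _ Y]) (auto simp: relax_feasible_def)
qed

lemma relax_value_le_relax_value_at: "relax_value K Q c A b \<le> relax_value_at K Q c A b x"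
  unfolding relax_value_def relax_value_at_def by (rule INF_superset_mono) auto

lemma exists_quadratic_le:
  fixes q \<beta> \<delta> B :: real
  assumes "\<delta> < 0"
  shows "\<exists>t\<ge>0. q + t * \<beta> + t\<^sup>2 * \<delta> \<le> B"
proof -
  \<comment> \<open>The quotient lets \<open>t * \<delta>\<close> absorb both \<open>\<beta>\<close>
    and the gap \<open>B - q\<close>. The summand 1 gives \<open>t \<ge> 1\<close>, so multiplying
    the resulting nonpositive bound by \<open>t\<close> only lowers it.\<close>
  define t where "t = 1 + (\<bar>\<beta>\<bar> + \<bar>B - q\<bar>) / - \<delta>"
  have t: "t \<ge> 1" using assms by (simp add: t_def divide_nonneg_neg)
  have "t * \<delta> = \<delta> - \<bar>\<beta>\<bar> - \<bar>B - q\<bar>"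
    using assms by (simp add: t_def field_simps)
  then have le: "t * \<delta> + \<beta> \<le> - \<bar>B - q\<bar>" using assms by linarith
  have "t * (t * \<delta> + \<beta>) \<le> t * (- \<bar>B - q\<bar>)"
    using le t by (intro mult_left_mono) auto
  also have "\<dots> \<le> - \<bar>B - q\<bar>"
    using mult_right_mono[OF t, of "\<bar>B - q\<bar>"] by simp
  finally have "q + t * \<beta> + t\<^sup>2 * \<delta> \<le> B"
    by (simp add: power2_eq_square algebra_simps)
  with t show ?thesis by (intro exI[of _ t]) auto
qed

text \<open>Sorted by powers of \<open>t\<close> to match
  \<open>exists_quadratic_le\<close>.\<close>

lemma qp_objective_along_ray:
  "qp_objective Q c (x + t *\<^sub>R d) = qp_objective Q c x
     + t * (x \<bullet> (Q *v d) + d \<bullet> (Q *v x) + 2 * (c \<bullet> d)) + t\<^sup>2 * (d \<bullet> (Q *v d))"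
  by (simp add: qp_objective_def matrix_vector_right_distrib matrix_vector_mult_scaleR
      inner_add_left inner_add_right power2_eq_square algebra_simps)

lemma qp_value_eq_MInf:
  assumes x: "x \<in> qp_feasible A b" and d: "d \<in> L_infinity Q A"
  shows "qp_value Q c A b = - \<infinity>"
  unfolding qp_value_def
proof (rule INF_ereal_eq_MInfI)
  fix B
  have d': "A *v d = 0" "0 \<le> d" "d \<bullet> (Q *v d) < 0"
    using d by (auto simp: L_infinity_def)
  obtain t where t: "t \<ge> 0" "qp_objective Q c (x + t *\<^sub>R d) \<le> B"
    unfolding qp_objective_along_ray using exists_quadratic_le[OF d'(3)] by metis
  \<comment> \<open>\<open>d\<close> is a recession direction of the feasible set:
    \<open>A *v d = 0\<close> preserves the equations, and \<open>0 \<le> d\<close> with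
    \<open>t \<ge> 0\<close> preserves the signs.\<close>
  have "x + t *\<^sub>R d \<in> qp_feasible A b"
    using x d' t(1)
    by (simp add: qp_feasible_def matrix_vector_right_distrib matrix_vector_mult_scaleR
        less_eq_vec_def)
  with t(2) show "\<exists>y\<in>qp_feasible A b. qp_objective Q c y \<le> B" by blast
qed

theorem proposition4p3:
  fixes Q :: "real ^ 'n ^ 'n" and c :: "real ^ 'n"
    and A :: "real ^ 'n ^ 'm" and b :: "real ^ 'm"
  assumes "transpose Q = Q"
    and "qp_feasible A b \<noteq> {}"
    and "L_infinity Q A \<noteq> {}"
  shows "\<forall>K\<in>cone_family.
           (\<forall>x\<in>qp_feasible A b. relax_value_at K Q c A b x = - \<infinity>) \<and>
           relax_value K Q c A b = qp_value Q c A b \<and> qp_value Q c A b = - \<infinity>"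
proof
  fix K :: "(real ^ 'n option ^ 'n option) set"
  assume "K \<in> cone_family"
  then have K: "completely_positive \<subseteq> K" by (simp add: cone_family_def)
  obtain x d where x: "x \<in> qp_feasible A b" and d: "d \<in> L_infinity Q A"
    using assms(2,3) by blast
  have "relax_value K Q c A b = - \<infinity>"
    using relax_value_le_relax_value_at[of K Q c A b x] relax_value_at_eq_MInf[OF K x d] by simp
  then show "(\<forall>x\<in>qp_feasible A b. relax_value_at K Q c A b x = - \<infinity>) \<and>
      relax_value K Q c A b = qp_value Q c A b \<and> qp_value Q c A b = - \<infinity>"
    \<comment> \<open>The feasible point is left open because the same \<open>d\<close> serves all
      of them.\<close>
    using relax_value_at_eq_MInf[OF K _ d] qp_value_eq_MInf[OF x d] by simp
qed

end
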